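(* Let $(X,d)$ be a metric space. The Fréchet distance $d_F$ defines a metric on the space of nowhere constant curves in $(X,d)$.
   Context: A path in $X$ is a continuous map $\gamma\colon[0,1]\to X$. A parametrization is a strictly increasing surjective (hence continuous) map $\varphi\colon[0,1]\to[0,1]$. Two paths $\gamma,\tilde\gamma$ are equivalent if $\gamma=\tilde\gamma\circ\varphi$ for some parametrization $\varphi$. A curve is an equivalence class $[\gamma]$ of paths under this equivalence relation. A path is nowhere constant if it is not constant on any non-trivial subinterval of $[0,1]$; this notion descends to curves. The Fréchet distance between curves is $$d_F([\gamma],[\sigma])=\inf_{\varphi,\psi}\ \max_{t\in[0,1]}d(\gamma(\varphi(t)),\sigma(\psi(t))),$$ where $\varphi,\psi$ run over all parametrizations. *)

theory Defs
  imports "HOL-Analysis.Abstract_Metric_Spaces"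
begin

definition parametrization :: "(real \<Rightarrow> real) \<Rightarrow> bool"
  where "parametrization \<phi> \<longleftrightarrow> strict_mono_on {0..1} \<phi> \<and> \<phi> ` {0..1} = {0..1}"

definition nowhere_constant :: "(real \<Rightarrow> 'a) \<Rightarrow> bool"
  where "nowhere_constant \<gamma> \<longleftrightarrow> (\<forall>a b. 0 \<le> a \<and> a < b \<and> b \<le> 1 \<longrightarrow> \<not> \<gamma> constant_on {a..b})"

lemma parametrization_id: "parametrization (\<lambda>t. t)"
  by (simp add: parametrization_def strict_mono_on_def)

lemma parametrization_in: "parametrization \<phi> \<Longrightarrow> t \<in> {0..1} \<Longrightarrow> \<phi> t \<in> {0..1}"
  unfolding parametrization_def by blast

lemma parametrization_comp:
  assumes "parametrization \<phi>" "parametrization \<psi>"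
  shows "parametrization (\<lambda>t. \<phi> (\<psi> t))"
proof -
  have "strict_mono_on {0..1} (\<lambda>t. \<phi> (\<psi> t))"
  proof (rule strict_mono_onI)
    fix s t :: real assume "s \<in> {0..1}" "t \<in> {0..1}" "s < t"
    then have "\<psi> s < \<psi> t" "\<psi> s \<in> {0..1}" "\<psi> t \<in> {0..1}"
      using assms(2) parametrization_in[OF assms(2)] strict_mono_onD
      unfolding parametrization_def by blast+
    then show "\<phi> (\<psi> s) < \<phi> (\<psi> t)"
      using assms(1) strict_mono_onD unfolding parametrization_def by blast
  qed
  moreover have "(\<lambda>t. \<phi> (\<psi> t)) ` {0..1} = \<phi> ` (\<psi> ` {0..1})"
    by (simp only: image_image)
  ultimately show ?thesis
    using assms by (simp add: parametrization_def)
qed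

lemma parametrization_inverse:
  assumes "parametrization \<phi>"
  obtains \<psi> where "parametrization \<psi>"
    "\<And>t. t \<in> {0..1} \<Longrightarrow> \<phi> (\<psi> t) = t" "\<And>t. t \<in> {0..1} \<Longrightarrow> \<psi> (\<phi> t) = t"
proof -
  let ?\<psi> = "inv_into {0..1} \<phi>"
  have sm: "\<And>s t. s \<in> {0..1} \<Longrightarrow> t \<in> {0..1} \<Longrightarrow> s < t \<Longrightarrow> \<phi> s < \<phi> t"
    and im: "\<phi> ` {0..1} = {0..1}"
    using assms by (auto simp: parametrization_def strict_mono_on_def)
  have inj: "inj_on \<phi> {0..1}"
    using sm by (metis inj_onI linorder_neq_iff)
  have r: "\<phi> (?\<psi> t) = t" and i: "?\<psi> t \<in> {0..1}" if "t \<in> {0..1}" for t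
    using that im by (metis f_inv_into_f, metis inv_into_into)
  have l: "?\<psi> (\<phi> t) = t" if "t \<in> {0..1}" for t
    using that inj by simp
  have "?\<psi> s < ?\<psi> t" if "s \<in> {0..1}" "t \<in> {0..1}" "s < t" for s t
    using sm[OF i i, of t s] r that by (metis linorder_neq_iff order_less_asym)
  moreover have "?\<psi> ` {0..1} = {0..1}"
    using inj im by (metis inv_into_image_cancel subset_refl)
  ultimately have "parametrization ?\<psi>"
    by (simp add: parametrization_def strict_mono_on_def)
  with r l show ?thesis using that by blast
qed

context Metric_space
begin

text \<open>
  Paths are functions on the whole real line of which only the values on \<open>[0,1]\<close> matter;
  \<open>path_equiv\<close> identifies functions that agree on \<open>[0,1]\<close>, so a curve does not depend
  on the values elsewhere.
\<close>

definition path_equiv :: "((real \<Rightarrow> 'a) \<times> (real \<Rightarrow> 'a)) set"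
  where "path_equiv = {(\<gamma>, \<gamma>'). pathin mtopology \<gamma> \<and> pathin mtopology \<gamma>' \<and>
           (\<exists>\<phi>. parametrization \<phi> \<and> (\<forall>t\<in>{0..1}. \<gamma> t = \<gamma>' (\<phi> t)))}"

definition curve_of :: "(real \<Rightarrow> 'a) \<Rightarrow> (real \<Rightarrow> 'a) set"
  where "curve_of \<gamma> = path_equiv `` {\<gamma>}"

definition curves :: "(real \<Rightarrow> 'a) set set"
  where "curves = {\<gamma>. pathin mtopology \<gamma>} // path_equiv"

definition nowhere_constant_curves :: "(real \<Rightarrow> 'a) set set"
  where "nowhere_constant_curves = {\<Gamma> \<in> curves. \<forall>\<gamma>\<in>\<Gamma>. nowhere_constant \<gamma>}"

text \<open>
  The supremum is a maximum for paths, by continuity and compactness of \<open>[0,1]\<close>.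
\<close>

definition path_frechet_dist :: "(real \<Rightarrow> 'a) \<Rightarrow> (real \<Rightarrow> 'a) \<Rightarrow> real"
  where "path_frechet_dist \<gamma> \<sigma> =
    (INF (\<phi>, \<psi>) \<in> {\<phi>. parametrization \<phi>} \<times> {\<psi>. parametrization \<psi>}.
       SUP t\<in>{0..1}. d (\<gamma> (\<phi> t)) (\<sigma> (\<psi> t)))"

text \<open>
  The descent of \<open>path_frechet_dist\<close> to curves; the value 0 off the set of curves is a
  convention, needed because \<^locale>\<open>Metric_space\<close> requires nonnegativity and symmetry
  for all elements of the ambient type.
\<close>

definition frechet_dist :: "(real \<Rightarrow> 'a) set \<Rightarrow> (real \<Rightarrow> 'a) set \<Rightarrow> real"
  where "frechet_dist \<Gamma> \<Sigma> =
    (if \<Gamma> \<in> curves \<and> \<Sigma> \<in> curves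
     then the_elem (\<Union>\<gamma>\<in>\<Gamma>. \<Union>\<sigma>\<in>\<Sigma>. {path_frechet_dist \<gamma> \<sigma>}) else 0)"

lemma equiv_path_equiv: "equiv {\<gamma>. pathin mtopology \<gamma>} path_equiv"
proof (rule equivI)
  show "path_equiv \<subseteq> {\<gamma>. pathin mtopology \<gamma>} \<times> {\<gamma>. pathin mtopology \<gamma>}"
    by (auto simp: path_equiv_def)
  show "refl_on {\<gamma>. pathin mtopology \<gamma>} path_equiv"
    using parametrization_id by (auto simp: refl_on_def path_equiv_def)
  show "sym path_equiv"
  proof (rule symI)
    fix \<gamma> \<gamma>' assume "(\<gamma>, \<gamma>') \<in> path_equiv"
    then obtain \<phi> where p: "pathin mtopology \<gamma>" "pathin mtopology \<gamma>'"
      and \<phi>: "parametrization \<phi>" "\<And>t. t \<in> {0..1} \<Longrightarrow> \<gamma> t = \<gamma>' (\<phi> t)"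
      by (auto simp: path_equiv_def)
    obtain \<psi> where \<psi>: "parametrization \<psi>" "\<And>t. t \<in> {0..1} \<Longrightarrow> \<phi> (\<psi> t) = t"
      using parametrization_inverse[OF \<phi>(1)] by metis
    have "\<forall>t\<in>{0..1}. \<gamma>' t = \<gamma> (\<psi> t)"
      using \<phi>(2) \<psi>(2) parametrization_in[OF \<psi>(1)] by metis
    then show "(\<gamma>', \<gamma>) \<in> path_equiv"
      using p \<psi>(1) unfolding path_equiv_def by blast
  qed
  show "trans path_equiv"
  proof (rule transI)
    fix \<gamma> \<gamma>' \<gamma>'' assume "(\<gamma>, \<gamma>') \<in> path_equiv" "(\<gamma>', \<gamma>'') \<in> path_equiv"
    then obtain \<phi> \<psi> where p: "pathin mtopology \<gamma>" "pathin mtopology \<gamma>''"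
      and \<phi>: "parametrization \<phi>" "\<And>t. t \<in> {0..1} \<Longrightarrow> \<gamma> t = \<gamma>' (\<phi> t)"
      and \<psi>: "parametrization \<psi>" "\<And>t. t \<in> {0..1} \<Longrightarrow> \<gamma>' t = \<gamma>'' (\<psi> t)"
      by (auto simp: path_equiv_def)
    have "\<forall>t\<in>{0..1}. \<gamma> t = \<gamma>'' (\<psi> (\<phi> t))"
      using \<phi> \<psi> parametrization_in[OF \<phi>(1)] by metis
    then show "(\<gamma>, \<gamma>'') \<in> path_equiv"
      using p parametrization_comp[OF \<psi>(1) \<phi>(1)] unfolding path_equiv_def by blast
  qed
qed

lemma curve_of_in_curves: "pathin mtopology \<gamma> \<Longrightarrow> curve_of \<gamma> \<in> curves"
  by (simp add: curve_of_def curves_def quotientI)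

lemma in_curve_of: "pathin mtopology \<gamma> \<Longrightarrow> \<gamma> \<in> curve_of \<gamma>"
  unfolding curve_of_def using equiv_class_self[OF equiv_path_equiv] by simp

lemma nowhere_constant_path_equiv:
  assumes "(\<gamma>, \<gamma>') \<in> path_equiv" and nc: "nowhere_constant \<gamma>"
  shows "nowhere_constant \<gamma>'"
  unfolding nowhere_constant_def
proof (intro allI impI notI)
  fix a b :: real assume ab: "0 \<le> a \<and> a < b \<and> b \<le> 1" and c: "\<gamma>' constant_on {a..b}"
  obtain \<phi> where \<phi>: "parametrization \<phi>" "\<And>t. t \<in> {0..1} \<Longrightarrow> \<gamma> t = \<gamma>' (\<phi> t)"
    using assms(1) by (auto simp: path_equiv_def)
  have sm: "\<And>s t. s \<in> {0..1} \<Longrightarrow> t \<in> {0..1} \<Longrightarrow> s < t \<Longrightarrow> \<phi> s < \<phi> t"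
    using \<phi>(1) by (auto simp: parametrization_def strict_mono_on_def)
  have ab01: "a \<in> {0..1}" "b \<in> {0..1}" using ab by auto
  have im: "\<phi> ` {0..1} = {0..1}" using \<phi>(1) by (simp add: parametrization_def)
  obtain s t where st: "s \<in> {0..1}" "t \<in> {0..1}" "\<phi> s = a" "\<phi> t = b"
    using ab01 im by (metis imageE)
  have "s < t" using sm[OF st(2,1)] st ab by (metis linorder_neq_iff order_less_asym)
  moreover have "\<phi> u \<in> {a..b}" and "\<gamma> u = \<gamma>' (\<phi> u)" if "u \<in> {s..t}" for u
  proof -
    have u: "u \<in> {0..1}" using that st by auto
    show "\<phi> u \<in> {a..b}"
      using sm[OF st(1) u] sm[OF u st(2)] st that by (cases "u = s"; cases "u = t") auto
    show "\<gamma> u = \<gamma>' (\<phi> u)" using \<phi>(2) u by blast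
  qed
  ultimately have "\<gamma> constant_on {s..t}" 
    using c unfolding constant_on_def by metis
  then show False
    using nc \<open>s < t\<close> st(1,2) unfolding nowhere_constant_def by auto
qed

lemma curve_of_in_nowhere_constant_curves_iff:
  assumes "pathin mtopology \<gamma>"
  shows "curve_of \<gamma> \<in> nowhere_constant_curves \<longleftrightarrow> nowhere_constant \<gamma>"
proof
  assume "curve_of \<gamma> \<in> nowhere_constant_curves"
  then show "nowhere_constant \<gamma>"
    using in_curve_of[OF assms] by (simp add: nowhere_constant_curves_def)
next
  assume "nowhere_constant \<gamma>"
  then have "\<forall>\<gamma>'\<in>curve_of \<gamma>. nowhere_constant \<gamma>'"
    using nowhere_constant_path_equiv unfolding curve_of_def by blast
  then show "curve_of \<gamma> \<in> nowhere_constant_curves"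
    using curve_of_in_curves[OF assms] by (simp add: nowhere_constant_curves_def)
qed

lemma path_frechet_dist_cong:
  assumes "(\<gamma>, \<gamma>') \<in> path_equiv" "(\<sigma>, \<sigma>') \<in> path_equiv"
  shows "path_frechet_dist \<gamma> \<sigma> = path_frechet_dist \<gamma>' \<sigma>'"
proof -
  let ?P = "{\<phi>. parametrization \<phi>} \<times> {\<psi>. parametrization \<psi>}"
  let ?V = "\<lambda>\<gamma> \<sigma>. (\<lambda>(\<phi>, \<psi>). SUP t\<in>{0..1}. d (\<gamma> (\<phi> t)) (\<sigma> (\<psi> t))) ` ?P"
  have sub: "?V \<gamma> \<sigma> \<subseteq> ?V \<gamma>' \<sigma>'"
    if eqv: "(\<gamma>, \<gamma>') \<in> path_equiv" "(\<sigma>, \<sigma>') \<in> path_equiv" for \<gamma> \<gamma>' \<sigma> \<sigma>'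
  proof
    fix x assume "x \<in> ?V \<gamma> \<sigma>"
    then obtain \<phi> \<psi> where \<phi>: "parametrization \<phi>" and \<psi>: "parametrization \<psi>"
      and x: "x = (SUP t\<in>{0..1}. d (\<gamma> (\<phi> t)) (\<sigma> (\<psi> t)))"
      by auto
    obtain \<alpha> where \<alpha>: "parametrization \<alpha>" "\<And>t. t \<in> {0..1} \<Longrightarrow> \<gamma> t = \<gamma>' (\<alpha> t)"
      using eqv(1) unfolding path_equiv_def by blast
    obtain \<beta> where \<beta>: "parametrization \<beta>" "\<And>t. t \<in> {0..1} \<Longrightarrow> \<sigma> t = \<sigma>' (\<beta> t)"
      using eqv(2) unfolding path_equiv_def by blast
    have "x = (SUP t\<in>{0..1}. d (\<gamma>' (\<alpha> (\<phi> t))) (\<sigma>' (\<beta> (\<psi> t))))"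
      unfolding x using \<alpha>(2)[OF parametrization_in[OF \<phi>]] \<beta>(2)[OF parametrization_in[OF \<psi>]]
      by (intro SUP_cong refl) presburger
    then show "x \<in> ?V \<gamma>' \<sigma>'"
      using parametrization_comp[OF \<alpha>(1) \<phi>] parametrization_comp[OF \<beta>(1) \<psi>]
      by (intro image_eqI[where x = "(\<lambda>t. \<alpha> (\<phi> t), \<lambda>t. \<beta> (\<psi> t))"]) simp_all
  qed
  have "(\<gamma>', \<gamma>) \<in> path_equiv" "(\<sigma>', \<sigma>) \<in> path_equiv"
    using assms equiv_path_equiv by (meson equiv_def symD)+
  then have "?V \<gamma> \<sigma> = ?V \<gamma>' \<sigma>'"
    using sub[OF assms] sub[of \<gamma>' \<gamma> \<sigma>' \<sigma>] by blast
  then show ?thesis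
    by (simp add: path_frechet_dist_def)
qed

lemma frechet_dist_curve_of:
  assumes "pathin mtopology \<gamma>" "pathin mtopology \<sigma>"
  shows "frechet_dist (curve_of \<gamma>) (curve_of \<sigma>) = path_frechet_dist \<gamma> \<sigma>"
proof -
  have "(\<Union>\<gamma>'\<in>curve_of \<gamma>. \<Union>\<sigma>'\<in>curve_of \<sigma>. {path_frechet_dist \<gamma>' \<sigma>'}) = {path_frechet_dist \<gamma> \<sigma>}"
  proof -
    have "path_frechet_dist \<gamma>' \<sigma>' = path_frechet_dist \<gamma> \<sigma>"
      if "\<gamma>' \<in> curve_of \<gamma>" "\<sigma>' \<in> curve_of \<sigma>" for \<gamma>' \<sigma>'
      using that path_frechet_dist_cong[of \<gamma> \<gamma>' \<sigma> \<sigma>'] by (simp add: curve_of_def)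
    then show ?thesis
      using in_curve_of[OF assms(1)] in_curve_of[OF assms(2)] by blast
  qed
  then show ?thesis
    using assms by (simp add: frechet_dist_def curve_of_in_curves)
qed

end

end

theory Submission imports Defs begin

text \<open>
  Reparametrising one side turns the Frechet distance of two paths into the infimum of the
  \<open>e\<close> for which a single parametrization \<open>\<phi>\<close> keeps \<open>\<gamma>\<close> within \<open>e\<close> of \<open>\<sigma> \<circ> \<phi>\<close>
  (\<open>path_frechet_dist_lessE\<close>, \<open>path_frechet_dist_le\<close>). As parametrizations form a group
  under composition, symmetry and the triangle inequality follow.

  The substance is definiteness. Distance zero yields parametrizations \<open>\<phi>\<^sub>n\<close> for which
  \<open>\<sigma> \<circ> \<phi>\<^sub>n\<close> tends to \<open>\<gamma>\<close> uniformly, but says nothing directly about convergence of \<open>\<phi>\<^sub>n\<close>.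
  Rather than selecting a convergent subsequence, consider the pointwise upper limit
  \<open>F t = limsup \<phi>\<^sub>n t\<close>. It is monotone, and since every \<open>F t\<close> is a cluster point of
  \<open>\<phi>\<^sub>n t\<close>, continuity of \<open>\<sigma>\<close> gives \<open>\<gamma> = \<sigma> \<circ> F\<close> on the whole interval. Two failures could keep
  \<open>F\<close> from being a parametrization, and each contradicts one of the hypotheses:
  if \<open>F\<close> is constant on an interval, then so is \<open>\<gamma>\<close>; and if \<open>F\<close> jumps at \<open>t\<close>, then \<open>\<phi>\<^sub>n\<close> sweeps,
  for infinitely many \<open>n\<close>, across any given value of the gap within an arbitrarily short time
  around \<open>t\<close>, so that \<open>\<sigma>\<close> takes the value \<open>\<gamma> t\<close> on the entire gap (\<open>gap_value\<close>).
\<close>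

section \<open>Upper limits of bounded real sequences\<close>

text \<open>
  For bounded sequences this is the limes superior. The form below stays within the reals,
  which are not a complete lattice, and states directly what is used: membership of \<open>x\<close> in the
  set means that infinitely many terms are at least \<open>x\<close>.
\<close>

definition upper_limit :: "(nat \<Rightarrow> real) \<Rightarrow> real"
  where "upper_limit a = Sup {x. \<exists>\<^sub>F n in sequentially. x \<le> a n}"

lemma bdd_above_frequently_le:
  fixes a :: "nat \<Rightarrow> real"
  assumes "\<And>n. a n \<in> {0..1}"
  shows "bdd_above {x. \<exists>\<^sub>F n in sequentially. x \<le> a n}"
proof (rule bdd_aboveI[where M = 1])
  fix x assume "x \<in> {x. \<exists>\<^sub>F n in sequentially. x \<le> a n}"
  then obtain n where "x \<le> a n" using frequently_ex by blast
  then show "x \<le> 1" using assms[of n] by simp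
qed

lemma zero_frequently_le:
  fixes a :: "nat \<Rightarrow> real"
  assumes "\<And>n. a n \<in> {0..1}"
  shows "0 \<in> {x. \<exists>\<^sub>F n in sequentially. x \<le> a n}"
  using assms by simp

lemma frequently_of_less_upper_limit:
  assumes "\<And>n. a n \<in> {0..1}" "x < upper_limit a"
  shows "\<exists>\<^sub>F n in sequentially. x \<le> a n"
proof -
  have "{x. \<exists>\<^sub>F n in sequentially. x \<le> a n} \<noteq> {}"
    using zero_frequently_le[of a] assms(1) by blast
  then obtain y where y: "\<exists>\<^sub>F n in sequentially. y \<le> a n" "x < y"
    using less_cSupE[OF assms(2)[unfolded upper_limit_def]] by blast
  show ?thesis
    by (rule frequently_elim1[OF y(1)]) (use y(2) in linarith)
qed

lemma eventually_of_upper_limit_less: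
  assumes "\<And>n. a n \<in> {0..1}" "upper_limit a < x"
  shows "\<forall>\<^sub>F n in sequentially. a n < x"
proof -
  have "\<not> (\<exists>\<^sub>F n in sequentially. x \<le> a n)"
    using cSup_upper[OF _ bdd_above_frequently_le[OF assms(1)], of x] assms(2)
    unfolding upper_limit_def by fastforce
  then show ?thesis
    by (simp add: frequently_def not_le)
qed

lemma upper_limit_const: "upper_limit (\<lambda>n. c) = c"
proof -
  have "{x. \<exists>\<^sub>F n in sequentially. x \<le> c} = {..c}" by auto
  then show ?thesis by (simp add: upper_limit_def)
qed

lemma upper_limit_mono:
  assumes "\<And>n. a n \<in> {0..1}" "\<And>n. b n \<in> {0..1}" "\<And>n. a n \<le> b n"
  shows "upper_limit a \<le> upper_limit b"
  unfolding upper_limit_def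
proof (rule cSup_subset_mono)
  show "{x. \<exists>\<^sub>F n in sequentially. x \<le> a n} \<noteq> {}"
    using zero_frequently_le[of a] assms(1) by blast
  show "bdd_above {x. \<exists>\<^sub>F n in sequentially. x \<le> b n}"
    by (rule bdd_above_frequently_le[OF assms(2)])
  show "{x. \<exists>\<^sub>F n in sequentially. x \<le> a n} \<subseteq> {x. \<exists>\<^sub>F n in sequentially. x \<le> b n}"
    using assms(3) by (auto elim!: frequently_elim1 intro: order_trans)
qed

lemma upper_limit_in:
  assumes "\<And>n. a n \<in> {0..1}"
  shows "upper_limit a \<in> {0..1}"
  using upper_limit_mono[of "\<lambda>n. 0" a] upper_limit_mono[of a "\<lambda>n. 1"] assms
  by (auto simp: upper_limit_const)

lemma frequently_near_upper_limit:
  assumes "\<And>n. a n \<in> {0..1}" "0 < e"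
  shows "\<exists>\<^sub>F n in sequentially. \<bar>a n - upper_limit a\<bar> < e"
proof -
  have "\<exists>\<^sub>F n in sequentially. upper_limit a - e / 2 \<le> a n"
    using assms by (intro frequently_of_less_upper_limit) auto
  moreover have "\<forall>\<^sub>F n in sequentially. a n < upper_limit a + e"
    using assms by (intro eventually_of_upper_limit_less) auto
  ultimately have "\<exists>\<^sub>F n in sequentially.
      a n < upper_limit a + e \<and> upper_limit a - e / 2 \<le> a n"
    by (rule frequently_eventually_conj)
  then show ?thesis
    by (rule frequently_elim1) (use assms(2) in \<open>auto simp: abs_less_iff\<close>)
qed

section \<open>Parametrizations\<close>

lemma parametrization_less_iff:
  assumes "parametrization \<phi>" "s \<in> {0..1}" "t \<in> {0..1}"
  shows "\<phi> s < \<phi> t \<longleftrightarrow> s < t"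
  using assms(1)[unfolded parametrization_def] assms(2,3)
  by (intro strict_mono_on_less[of "{0..1}" \<phi>]) simp_all

lemma parametrization_le_iff:
  assumes "parametrization \<phi>" "s \<in> {0..1}" "t \<in> {0..1}"
  shows "\<phi> s \<le> \<phi> t \<longleftrightarrow> s \<le> t"
  using parametrization_less_iff[OF assms(1,3,2)] by linarith

lemma parametrization_ends:
  assumes "parametrization \<phi>"
  shows "\<phi> 0 = 0" "\<phi> 1 = 1"
proof -
  have im: "\<phi> ` {0..1} = {0..1}" using assms by (simp add: parametrization_def)
  have "0 \<in> \<phi> ` {0..1}" "1 \<in> \<phi> ` {0..1}"
    by (simp_all add: im)
  then obtain s t where st: "s \<in> {0..1}" "\<phi> s = 0" "t \<in> {0..1}" "\<phi> t = 1"
    by (auto elim!: imageE)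
  have "\<phi> 0 \<le> \<phi> s" "\<phi> t \<le> \<phi> 1"
    using st(1,3) parametrization_le_iff[OF assms, of 0 s] parametrization_le_iff[OF assms, of t 1]
    by simp_all
  then show "\<phi> 0 = 0" "\<phi> 1 = 1"
    using st(2,4) parametrization_in[OF assms, of 0] parametrization_in[OF assms, of 1] by auto
qed

context Metric_space
begin

section \<open>The Frechet distance of paths\<close>

lemma path_in_space:
  assumes "pathin mtopology \<gamma>" "t \<in> {0..1}"
  shows "\<gamma> t \<in> M"
  using continuous_map_image_subset_topspace[OF assms(1)[unfolded pathin_def]] assms(2)
  unfolding topspace_euclidean_subtopology topspace_mtopology by blast

lemma path_continuousE:
  assumes "pathin mtopology \<gamma>" "t \<in> {0..1}" "0 < e"
  obtains r where "0 < r" "\<And>s. s \<in> {0..1} \<Longrightarrow> \<bar>s - t\<bar> < r \<Longrightarrow> d (\<gamma> s) (\<gamma> t) < e"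
proof -
  obtain U where U: "openin (top_of_set {0..1}) U" "t \<in> U" "\<forall>y\<in>U. \<gamma> y \<in> mball (\<gamma> t) e"
    using assms unfolding pathin_def continuous_map_to_metric topspace_euclidean_subtopology
    by meson
  obtain r where r: "0 < r" "ball t r \<inter> {0..1} \<subseteq> U"
    using U(1,2) unfolding openin_contains_ball by blast
  have "d (\<gamma> s) (\<gamma> t) < e" if "s \<in> {0..1}" "\<bar>s - t\<bar> < r" for s
  proof -
    have "s \<in> U" using r(2) that by (auto simp: dist_real_def)
    then show ?thesis using U(3) by (auto simp: commute)
  qed
  then show thesis using r(1) that by blast
qed

lemma bdd_above_path_dist:
  assumes "pathin mtopology \<gamma>" "pathin mtopology \<sigma>" "parametrization \<phi>" "parametrization \<psi>"
  shows "bdd_above ((\<lambda>t. d (\<gamma> (\<phi> t)) (\<sigma> (\<psi> t))) ` {0..1})"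
proof -
  have "compactin mtopology (\<gamma> ` {0..1})" "compactin mtopology (\<sigma> ` {0..1})"
    using assms(1,2) by (auto simp: pathin_def compactin_subtopology intro!: image_compactin)
  then have "mbounded (\<gamma> ` {0..1} \<union> \<sigma> ` {0..1})"
    by (simp add: compactin_imp_mbounded mbounded_Un)
  then obtain B where B: "\<forall>x\<in>\<gamma> ` {0..1} \<union> \<sigma> ` {0..1}. \<forall>y\<in>\<gamma> ` {0..1} \<union> \<sigma> ` {0..1}. d x y \<le> B"
    unfolding mbounded_alt by (elim conjE exE)
  show ?thesis
  proof (rule bdd_aboveI2)
    fix t :: real assume t: "t \<in> {0..1}"
    show "d (\<gamma> (\<phi> t)) (\<sigma> (\<psi> t)) \<le> B"
      using B parametrization_in[OF assms(3) t] parametrization_in[OF assms(4) t] by blast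
  qed
qed

lemma path_dist_le_SUP:
  assumes "pathin mtopology \<gamma>" "pathin mtopology \<sigma>" "parametrization \<phi>" "parametrization \<psi>"
    and "t \<in> {0..1}"
  shows "d (\<gamma> (\<phi> t)) (\<sigma> (\<psi> t)) \<le> (SUP t\<in>{0..1}. d (\<gamma> (\<phi> t)) (\<sigma> (\<psi> t)))"
  using assms(5) bdd_above_path_dist[OF assms(1-4)] by (rule cSUP_upper)

lemma SUP_path_dist_nonneg:
  assumes "pathin mtopology \<gamma>" "pathin mtopology \<sigma>" "parametrization \<phi>" "parametrization \<psi>"
  shows "0 \<le> (SUP t\<in>{0..1}. d (\<gamma> (\<phi> t)) (\<sigma> (\<psi> t)))"
  by (rule order_trans[OF nonneg path_dist_le_SUP[OF assms, of 0]]) simp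

lemma parametrization_pairs_nonempty:
  "{\<phi>. parametrization \<phi>} \<times> {\<psi>. parametrization \<psi>} \<noteq> {}"
  using parametrization_id by blast

lemma path_frechet_dist_nonneg:
  assumes "pathin mtopology \<gamma>" "pathin mtopology \<sigma>"
  shows "0 \<le> path_frechet_dist \<gamma> \<sigma>"
  unfolding path_frechet_dist_def using SUP_path_dist_nonneg[OF assms]
  by (intro cINF_greatest[OF parametrization_pairs_nonempty]) auto

lemma bdd_below_SUP_path_dist:
  assumes "pathin mtopology \<gamma>" "pathin mtopology \<sigma>"
  shows "bdd_below ((\<lambda>(\<phi>, \<psi>). SUP t\<in>{0..1}. d (\<gamma> (\<phi> t)) (\<sigma> (\<psi> t))) `
    ({\<phi>. parametrization \<phi>} \<times> {\<psi>. parametrization \<psi>}))"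
  using SUP_path_dist_nonneg[OF assms] by (intro bdd_belowI2[where m = 0]) auto

lemma path_frechet_dist_lessE:
  assumes "pathin mtopology \<gamma>" "pathin mtopology \<sigma>" "path_frechet_dist \<gamma> \<sigma> < e"
  obtains \<phi> where "parametrization \<phi>" "\<And>t. t \<in> {0..1} \<Longrightarrow> d (\<gamma> t) (\<sigma> (\<phi> t)) < e"
proof -
  obtain \<alpha> \<beta> where p: "parametrization \<alpha>" "parametrization \<beta>"
    and less: "(SUP t\<in>{0..1}. d (\<gamma> (\<alpha> t)) (\<sigma> (\<beta> t))) < e"
    using assms(3)
    unfolding path_frechet_dist_def
      cINF_less_iff[OF parametrization_pairs_nonempty bdd_below_SUP_path_dist[OF assms(1,2)]]
    by (elim bexE SigmaE) simp
  obtain \<alpha>' where \<alpha>': "parametrization \<alpha>'" "\<And>t. t \<in> {0..1} \<Longrightarrow> \<alpha> (\<alpha>' t) = t"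
    using parametrization_inverse[OF p(1)] by metis
  have "d (\<gamma> t) (\<sigma> (\<beta> (\<alpha>' t))) < e" if t: "t \<in> {0..1}" for t
    using path_dist_le_SUP[OF assms(1,2) p parametrization_in[OF \<alpha>'(1) t]] \<alpha>'(2)[OF t] less
    by simp
  then show thesis
    using that[OF parametrization_comp[OF p(2) \<alpha>'(1)]] by simp
qed

lemma path_frechet_dist_le:
  assumes "pathin mtopology \<gamma>" "pathin mtopology \<sigma>" "parametrization \<phi>"
    and "\<And>t. t \<in> {0..1} \<Longrightarrow> d (\<gamma> t) (\<sigma> (\<phi> t)) \<le> e"
  shows "path_frechet_dist \<gamma> \<sigma> \<le> e"
proof -
  have "path_frechet_dist \<gamma> \<sigma> \<le> (SUP t\<in>{0..1}. d (\<gamma> t) (\<sigma> (\<phi> t)))"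
    using cINF_lower[OF bdd_below_SUP_path_dist[OF assms(1,2)], of "(\<lambda>t. t, \<phi>)"]
      parametrization_id assms(3)
    unfolding path_frechet_dist_def by simp
  also have "\<dots> \<le> e"
    using assms(4) by (intro cSUP_least) auto
  finally show ?thesis .
qed

lemma path_frechet_dist_commute_le:
  assumes "pathin mtopology \<gamma>" "pathin mtopology \<sigma>"
  shows "path_frechet_dist \<sigma> \<gamma> \<le> path_frechet_dist \<gamma> \<sigma>"
proof (rule dense_ge)
  fix e assume "path_frechet_dist \<gamma> \<sigma> < e"
  then obtain \<phi> where \<phi>: "parametrization \<phi>" "\<And>t. t \<in> {0..1} \<Longrightarrow> d (\<gamma> t) (\<sigma> (\<phi> t)) < e"
    using path_frechet_dist_lessE[OF assms] by blast
  obtain \<psi> where \<psi>: "parametrization \<psi>" "\<And>t. t \<in> {0..1} \<Longrightarrow> \<phi> (\<psi> t) = t"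
    using parametrization_inverse[OF \<phi>(1)] by metis
  show "path_frechet_dist \<sigma> \<gamma> \<le> e"
  proof (rule path_frechet_dist_le[OF assms(2,1) \<psi>(1)])
    fix t :: real assume t: "t \<in> {0..1}"
    show "d (\<sigma> t) (\<gamma> (\<psi> t)) \<le> e"
      using \<phi>(2)[OF parametrization_in[OF \<psi>(1) t]] \<psi>(2)[OF t] by (simp add: commute)
  qed
qed

lemma path_frechet_dist_triangle:
  assumes "pathin mtopology \<gamma>" "pathin mtopology \<sigma>" "pathin mtopology \<tau>"
  shows "path_frechet_dist \<gamma> \<tau> \<le> path_frechet_dist \<gamma> \<sigma> + path_frechet_dist \<sigma> \<tau>"
proof (rule field_le_epsilon)
  fix e :: real assume "0 < e"
  then have less: "path_frechet_dist \<gamma> \<sigma> < path_frechet_dist \<gamma> \<sigma> + e / 2"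
    "path_frechet_dist \<sigma> \<tau> < path_frechet_dist \<sigma> \<tau> + e / 2" by auto
  obtain \<phi> where \<phi>: "parametrization \<phi>"
      "\<And>t. t \<in> {0..1} \<Longrightarrow> d (\<gamma> t) (\<sigma> (\<phi> t)) < path_frechet_dist \<gamma> \<sigma> + e / 2"
    using path_frechet_dist_lessE[OF assms(1,2) less(1)] by blast
  obtain \<psi> where \<psi>: "parametrization \<psi>"
      "\<And>t. t \<in> {0..1} \<Longrightarrow> d (\<sigma> t) (\<tau> (\<psi> t)) < path_frechet_dist \<sigma> \<tau> + e / 2"
    using path_frechet_dist_lessE[OF assms(2,3) less(2)] by blast
  show "path_frechet_dist \<gamma> \<tau> \<le> path_frechet_dist \<gamma> \<sigma> + path_frechet_dist \<sigma> \<tau> + e"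
  proof (rule path_frechet_dist_le[OF assms(1,3) parametrization_comp[OF \<psi>(1) \<phi>(1)]])
    fix t :: real assume t: "t \<in> {0..1}"
    note \<phi>t = parametrization_in[OF \<phi>(1) t]
    have "d (\<gamma> t) (\<tau> (\<psi> (\<phi> t))) \<le> d (\<gamma> t) (\<sigma> (\<phi> t)) + d (\<sigma> (\<phi> t)) (\<tau> (\<psi> (\<phi> t)))"
      by (rule triangle[OF path_in_space[OF assms(1) t] path_in_space[OF assms(2) \<phi>t]
          path_in_space[OF assms(3) parametrization_in[OF \<psi>(1) \<phi>t]]])
    then show "d (\<gamma> t) (\<tau> (\<psi> (\<phi> t))) \<le> path_frechet_dist \<gamma> \<sigma> + path_frechet_dist \<sigma> \<tau> + e"
      using \<phi>(2)[OF t] \<psi>(2)[OF \<phi>t] by linarith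
  qed
qed

section \<open>Definiteness\<close>

lemma eq_if_frequently_near:
  assumes "x \<in> M" "y \<in> M"
    and "\<And>e. 0 < e \<Longrightarrow> \<exists>\<^sub>F n in sequentially. d x y \<le> inverse (Suc n) + e"
  shows "x = y"
proof (rule ccontr)
  assume "x \<noteq> y"
  then have pos: "0 < d x y" using assms(1,2) by simp
  have "\<forall>\<^sub>F n in sequentially. inverse (real (Suc n)) < d x y / 2"
    using pos by (intro order_tendstoD(2)[OF LIMSEQ_inverse_real_of_nat]) simp
  then have "\<forall>\<^sub>F n in sequentially. \<not> d x y \<le> inverse (Suc n) + d x y / 2"
    by (rule eventually_mono) (simp add: not_le)
  moreover have "\<exists>\<^sub>F n in sequentially. d x y \<le> inverse (Suc n) + d x y / 2"
    using assms(3)[of "d x y / 2"] pos by simp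
  ultimately show False by (simp add: frequently_def)
qed

context
  fixes \<gamma> \<sigma> :: "real \<Rightarrow> 'a" and \<phi> :: "nat \<Rightarrow> real \<Rightarrow> real" and F :: "real \<Rightarrow> real"
  assumes \<gamma>: "pathin mtopology \<gamma>" and \<sigma>: "pathin mtopology \<sigma>"
    and \<phi>: "\<And>n. parametrization (\<phi> n)"
    and near: "\<And>n t. t \<in> {0..1} \<Longrightarrow> d (\<gamma> t) (\<sigma> (\<phi> n t)) < inverse (Suc n)"
  defines "F \<equiv> \<lambda>t. upper_limit (\<lambda>n. \<phi> n t)"
begin

lemma F_in: "t \<in> {0..1} \<Longrightarrow> F t \<in> {0..1}"
  unfolding F_def by (intro upper_limit_in parametrization_in[OF \<phi>])

lemma F_mono: "s \<in> {0..1} \<Longrightarrow> t \<in> {0..1} \<Longrightarrow> s \<le> t \<Longrightarrow> F s \<le> F t"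
  unfolding F_def
  by (intro upper_limit_mono parametrization_in[OF \<phi>]) (simp_all add: parametrization_le_iff[OF \<phi>])

lemma F_ends: "F 0 = 0" "F 1 = 1"
  by (simp_all add: F_def parametrization_ends[OF \<phi>] upper_limit_const)

lemma path_eq_comp_F:
  assumes t: "t \<in> {0..1}"
  shows "\<gamma> t = \<sigma> (F t)"
proof (rule eq_if_frequently_near)
  show "\<gamma> t \<in> M" "\<sigma> (F t) \<in> M"
    by (rule path_in_space[OF \<gamma> t], rule path_in_space[OF \<sigma> F_in[OF t]])
  fix e :: real assume "0 < e"
  then obtain r where r: "0 < r" "\<And>s. s \<in> {0..1} \<Longrightarrow> \<bar>s - F t\<bar> < r \<Longrightarrow> d (\<sigma> s) (\<sigma> (F t)) < e"
    using path_continuousE[OF \<sigma> F_in[OF t]] by blast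
  have "\<exists>\<^sub>F n in sequentially. \<bar>\<phi> n t - F t\<bar> < r"
    unfolding F_def
    by (intro frequently_near_upper_limit parametrization_in[OF \<phi>] t r(1))
  then show "\<exists>\<^sub>F n in sequentially. d (\<gamma> t) (\<sigma> (F t)) \<le> inverse (Suc n) + e"
  proof (rule frequently_elim1)
    fix n assume n: "\<bar>\<phi> n t - F t\<bar> < r"
    note \<phi>t = parametrization_in[OF \<phi> t, of n]
    have "d (\<gamma> t) (\<sigma> (F t)) \<le> d (\<gamma> t) (\<sigma> (\<phi> n t)) + d (\<sigma> (\<phi> n t)) (\<sigma> (F t))"
      by (rule triangle[OF path_in_space[OF \<gamma> t] path_in_space[OF \<sigma> \<phi>t]
          path_in_space[OF \<sigma> F_in[OF t]]])
    then show "d (\<gamma> t) (\<sigma> (F t)) \<le> inverse (Suc n) + e"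
      using near[OF t, of n] r(2)[OF \<phi>t n] by linarith
  qed
qed

text \<open>
  The value \<open>y\<close> lies in the gap of \<open>F\<close> at \<open>t\<close>. Just before \<open>t\<close> almost all \<open>\<phi>\<^sub>n\<close> are below \<open>y\<close>,
  just after \<open>t\<close> infinitely many are above it; hence infinitely many \<open>\<phi>\<^sub>n\<close> take the value \<open>y\<close>
  arbitrarily close to \<open>t\<close>.
\<close>

lemma gap_value:
  assumes t: "t \<in> {0..1}" and y: "y \<in> {0..1}"
    and below: "\<And>s. s \<in> {0..1} \<Longrightarrow> s < t \<Longrightarrow> F s < y"
    and above: "\<And>s. s \<in> {0..1} \<Longrightarrow> t < s \<Longrightarrow> y < F s"
  shows "\<sigma> y = \<gamma> t"
proof (rule eq_if_frequently_near)
  show "\<sigma> y \<in> M" "\<gamma> t \<in> M"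
    by (rule path_in_space[OF \<sigma> y], rule path_in_space[OF \<gamma> t])
  fix e :: real assume "0 < e"
  then obtain r where r: "0 < r" "\<And>s. s \<in> {0..1} \<Longrightarrow> \<bar>s - t\<bar> < r \<Longrightarrow> d (\<gamma> s) (\<gamma> t) < e"
    using path_continuousE[OF \<gamma> t] by blast
  define p where "p = max 0 (t - r / 2)"
  define q where "q = min 1 (t + r / 2)"
  have pq: "p \<in> {0..1}" "q \<in> {0..1}" "t - r < p" "q < t + r"
    using r(1) t by (auto simp: p_def q_def)
  have "\<forall>\<^sub>F n in sequentially. \<phi> n p \<le> y"
  proof (cases "p < t")
    case True
    then have "\<forall>\<^sub>F n in sequentially. \<phi> n p < y"
      using below[OF pq(1)] parametrization_in[OF \<phi> pq(1)]
      unfolding F_def by (intro eventually_of_upper_limit_less)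
    then show ?thesis by (rule eventually_mono) simp
  next
    case False
    then have "p = 0" using r(1) t by (auto simp: p_def)
    then show ?thesis using y by (simp add: parametrization_ends[OF \<phi>])
  qed
  moreover have "\<exists>\<^sub>F n in sequentially. y \<le> \<phi> n q"
  proof (cases "t < q")
    case True
    then show ?thesis
      using above[OF pq(2)] parametrization_in[OF \<phi> pq(2)]
      unfolding F_def by (intro frequently_of_less_upper_limit)
  next
    case False
    then have "q = 1" using r(1) t by (auto simp: q_def)
    then show ?thesis using y by (simp add: parametrization_ends[OF \<phi>])
  qed
  ultimately have "\<exists>\<^sub>F n in sequentially. \<phi> n p \<le> y \<and> y \<le> \<phi> n q"
    by (rule frequently_eventually_conj[rotated])
  then show "\<exists>\<^sub>F n in sequentially. d (\<sigma> y) (\<gamma> t) \<le> inverse (Suc n) + e"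
  proof (rule frequently_elim1)
    fix n assume n: "\<phi> n p \<le> y \<and> y \<le> \<phi> n q"
    obtain u where u: "u \<in> {0..1}" "y = \<phi> n u"
      using \<phi>[of n] y unfolding parametrization_def by blast
    have "\<bar>u - t\<bar> < r"
      using n u pq by (auto simp: parametrization_le_iff[OF \<phi>])
    moreover have "d (\<sigma> y) (\<gamma> t) \<le> d (\<sigma> y) (\<gamma> u) + d (\<gamma> u) (\<gamma> t)"
      by (rule triangle[OF path_in_space[OF \<sigma> y] path_in_space[OF \<gamma> u(1)]
          path_in_space[OF \<gamma> t]])
    ultimately show "d (\<sigma> y) (\<gamma> t) \<le> inverse (Suc n) + e"
      using near[OF u(1), of n] r(2)[OF u(1)] u(2) by (simp add: commute)
  qed
qed

lemma F_strict_mono: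
  assumes "nowhere_constant \<gamma>"
  shows "strict_mono_on {0..1} F"
proof (rule strict_mono_onI)
  fix s t :: real assume st: "s \<in> {0..1}" "t \<in> {0..1}" "s < t"
  show "F s < F t"
  proof (rule ccontr)
    assume not_less: "\<not> F s < F t"
    have "\<gamma> u = \<sigma> (F s)" if "u \<in> {s..t}" for u
    proof -
      have u: "u \<in> {0..1}" using that st by auto
      have "F u = F s"
        using F_mono[OF st(1) u] F_mono[OF u st(2)] not_less that by auto
      then show ?thesis using path_eq_comp_F[OF u] by simp
    qed
    then have "\<gamma> constant_on {s..t}" unfolding constant_on_def by blast
    then show False using assms st unfolding nowhere_constant_def by auto
  qed
qed

lemma F_surj:
  assumes "nowhere_constant \<sigma>"
  shows "F ` {0..1} = {0..1}"
proof
  show "F ` {0..1} \<subseteq> {0..1}" using F_in by blast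
  show "{0..1} \<subseteq> F ` {0..1}"
  proof (rule subsetI, rule ccontr)
    fix y :: real assume y: "y \<in> {0..1}" and "y \<notin> F ` {0..1}"
    then have avoid: "F s \<noteq> y" if "s \<in> {0..1}" for s using that by blast
    define S where "S = {s \<in> {0..1}. F s \<le> y}"
    define t where "t = Sup S"
    have S: "0 \<in> S" "bdd_above S" "\<And>s. s \<in> S \<Longrightarrow> s \<le> 1"
      using y F_ends by (auto simp: S_def bdd_above_def)
    have t: "t \<in> {0..1}"
      using cSup_upper[OF S(1,2)] cSup_least[of S 1] S(1,3) by (auto simp: t_def)
    have below: "F s < y" if s: "s \<in> {0..1}" "s < t" for s
    proof -
      obtain s' where s': "s' \<in> S" "s < s'"
        using less_cSup_iff[of S s] S s(2) unfolding t_def by blast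
      then have "F s \<le> F s'" using F_mono[OF s(1)] by (auto simp: S_def)
      then show ?thesis using s'(1) avoid[OF s(1)] by (auto simp: S_def)
    qed
    have above: "y < F s" if s: "s \<in> {0..1}" "t < s" for s
      using cSup_upper[OF _ S(2), of s] s unfolding t_def S_def by force
    \<comment> \<open>All of the interval between \<open>y\<close> and the midpoint of \<open>y\<close> and \<open>F t\<close> is in the gap at \<open>t\<close>;
      the midpoint keeps the value \<open>F t\<close> itself away.\<close>
    define z where "z = (F t + y) / 2"
    define a where "a = min y z"
    define b where "b = max y z"
    have "a < b" using avoid[OF t] by (auto simp: a_def b_def z_def min_def max_def field_simps)
    moreover have ab: "0 \<le> a" "b \<le> 1"
      using y F_in[OF t] by (auto simp: a_def b_def z_def)
    moreover have "\<sigma> x = \<gamma> t" if x: "x \<in> {a..b}" for x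
    proof (rule gap_value[OF t])
      show "x \<in> {0..1}" using x ab by auto
      show "F s < x" if s: "s \<in> {0..1}" "s < t" for s
        using x below[OF s] F_mono[OF s(1) t] s(2) avoid[OF t]
        by (auto simp: a_def z_def min_def split: if_splits)
      show "x < F s" if s: "s \<in> {0..1}" "t < s" for s
        using x above[OF s] F_mono[OF t s(1)] s(2) avoid[OF t]
        by (auto simp: b_def z_def max_def split: if_splits)
    qed
    then have "\<sigma> constant_on {a..b}" unfolding constant_on_def by blast
    ultimately show False using assms unfolding nowhere_constant_def by blast
  qed
qed

lemma path_equiv_of_approx:
  assumes "nowhere_constant \<gamma>" "nowhere_constant \<sigma>"
  shows "(\<gamma>, \<sigma>) \<in> path_equiv"
  using F_strict_mono[OF assms(1)] F_surj[OF assms(2)] path_eq_comp_F \<gamma> \<sigma>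
  unfolding path_equiv_def parametrization_def by blast

end

lemma path_equiv_if_path_frechet_dist_0:
  assumes \<gamma>: "pathin mtopology \<gamma>" "nowhere_constant \<gamma>"
    and \<sigma>: "pathin mtopology \<sigma>" "nowhere_constant \<sigma>"
    and "path_frechet_dist \<gamma> \<sigma> = 0"
  shows "(\<gamma>, \<sigma>) \<in> path_equiv"
proof -
  have "\<exists>\<phi>. parametrization \<phi> \<and> (\<forall>t\<in>{0..1}. d (\<gamma> t) (\<sigma> (\<phi> t)) < inverse (Suc n))" for n
    using path_frechet_dist_lessE[OF \<gamma>(1) \<sigma>(1), of "inverse (Suc n)"] assms(5)
    by (metis inverse_positive_iff_positive of_nat_0_less_iff zero_less_Suc)
  then obtain \<phi> where "\<And>n. parametrization (\<phi> n)"
    "\<And>n t. t \<in> {0..1} \<Longrightarrow> d (\<gamma> t) (\<sigma> (\<phi> n t)) < inverse (Suc n)"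
    by metis
  then show ?thesis
    using path_equiv_of_approx[OF \<gamma>(1) \<sigma>(1)] \<gamma>(2) \<sigma>(2) by blast
qed

lemma path_frechet_dist_self:
  assumes "pathin mtopology \<gamma>"
  shows "path_frechet_dist \<gamma> \<gamma> = 0"
proof (rule antisym)
  show "path_frechet_dist \<gamma> \<gamma> \<le> 0"
    using path_in_space[OF assms]
    by (intro path_frechet_dist_le[OF assms assms parametrization_id]) simp
qed (rule path_frechet_dist_nonneg[OF assms assms])

section \<open>Descent to curves\<close>

lemma curvesE:
  assumes "\<Gamma> \<in> curves"
  obtains \<gamma> where "pathin mtopology \<gamma>" "\<Gamma> = curve_of \<gamma>"
  using assms unfolding curves_def curve_of_def by (auto elim: quotientE)

lemma nowhere_constant_curvesE:
  assumes "\<Gamma> \<in> nowhere_constant_curves"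
  obtains \<gamma> where "pathin mtopology \<gamma>" "nowhere_constant \<gamma>" "\<Gamma> = curve_of \<gamma>"
proof -
  obtain \<gamma> where "pathin mtopology \<gamma>" "\<Gamma> = curve_of \<gamma>"
    using assms curvesE unfolding nowhere_constant_curves_def by blast
  then show thesis
    using that assms curve_of_in_nowhere_constant_curves_iff by blast
qed

lemma Metric_space_frechet_dist: "Metric_space nowhere_constant_curves frechet_dist"
proof
  fix \<Gamma> \<Sigma> :: "(real \<Rightarrow> 'a) set"
  show "0 \<le> frechet_dist \<Gamma> \<Sigma>"
  proof (cases "\<Gamma> \<in> curves \<and> \<Sigma> \<in> curves")
    case True
    then show ?thesis
      by (auto elim!: curvesE simp: frechet_dist_curve_of path_frechet_dist_nonneg)
  qed (simp only: frechet_dist_def if_False order_refl)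
  show "frechet_dist \<Gamma> \<Sigma> = frechet_dist \<Sigma> \<Gamma>"
  proof (cases "\<Gamma> \<in> curves \<and> \<Sigma> \<in> curves")
    case True
    then show ?thesis
      by (auto elim!: curvesE simp: frechet_dist_curve_of
          intro!: antisym path_frechet_dist_commute_le)
  qed (auto simp: frechet_dist_def)
next
  fix \<Gamma> \<Sigma> assume "\<Gamma> \<in> nowhere_constant_curves" "\<Sigma> \<in> nowhere_constant_curves"
  then obtain \<gamma> \<sigma> where \<gamma>: "pathin mtopology \<gamma>" "nowhere_constant \<gamma>" "\<Gamma> = curve_of \<gamma>"
    and \<sigma>: "pathin mtopology \<sigma>" "nowhere_constant \<sigma>" "\<Sigma> = curve_of \<sigma>"
    by (meson nowhere_constant_curvesE)
  show "frechet_dist \<Gamma> \<Sigma> = 0 \<longleftrightarrow> \<Gamma> = \<Sigma>"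
  proof
    assume "frechet_dist \<Gamma> \<Sigma> = 0"
    then have "(\<gamma>, \<sigma>) \<in> path_equiv"
      using \<gamma> \<sigma> by (intro path_equiv_if_path_frechet_dist_0) (simp_all add: frechet_dist_curve_of)
    then show "\<Gamma> = \<Sigma>"
      using equiv_class_eq[OF equiv_path_equiv] \<gamma>(3) \<sigma>(3) by (simp add: curve_of_def)
  next
    assume "\<Gamma> = \<Sigma>"
    then show "frechet_dist \<Gamma> \<Sigma> = 0"
      using frechet_dist_curve_of[OF \<gamma>(1) \<gamma>(1)] path_frechet_dist_self[OF \<gamma>(1)] \<gamma>(3) by simp
  qed
next
  fix \<Gamma> \<Sigma> \<Theta>
  assume "\<Gamma> \<in> nowhere_constant_curves" "\<Sigma> \<in> nowhere_constant_curves"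
    "\<Theta> \<in> nowhere_constant_curves"
  then obtain \<gamma> \<sigma> \<tau> where "pathin mtopology \<gamma>" "\<Gamma> = curve_of \<gamma>"
    "pathin mtopology \<sigma>" "\<Sigma> = curve_of \<sigma>" "pathin mtopology \<tau>" "\<Theta> = curve_of \<tau>"
    by (meson nowhere_constant_curvesE)
  then show "frechet_dist \<Gamma> \<Theta> \<le> frechet_dist \<Gamma> \<Sigma> + frechet_dist \<Sigma> \<Theta>"
    by (simp add: frechet_dist_curve_of path_frechet_dist_triangle)
qed

end

theorem propositionA3:
  fixes X :: "'a set" and d :: "'a \<Rightarrow> 'a \<Rightarrow> real"
  assumes "Metric_space X d"
  shows "Metric_space (Metric_space.nowhere_constant_curves X d) (Metric_space.frechet_dist X d)"
  using Metric_space.Metric_space_frechet_dist[OF assms] .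

end
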